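(* Let $G=(V,E,\mathrm{lab})$ be an edge-labeled graph over a set of labels $L$ and let $f$ be an inducing function. Write $H_\alpha$ for the solution to the problem LD-$\alpha$. There is $\tau$ such that $H_\tau$ also solves the problem LD. Moreover, for any $\alpha>\tau$, the graph $H_\alpha$ either solves LD or is empty.
   Context: An edge-labeled graph is a tuple $G=(V,E,\mathrm{lab})$, where $V$ is the set of vertices, $E$ is a set of undirected edges between distinct vertices, and $\mathrm{lab}:E\to 2^L$ maps each edge to its set of labels; $L$ is the set of all possible labels. An inducing function is a function $f$ that maps two sets of labels $(A;B)$ to a binary number. For $B\subseteq L$, the label-induced subgraph $G(f,B)$ has edge set $E(B)=\{e\in E: f(\mathrm{lab}(e);B)=1\}$ and vertex set $V(B)$ consisting of the vertices adjacent to $E(B)$. For a graph $H$ with vertex set $V(H)$ and edge set $E(H)$, the density is $d(H)=|E(H)|/|V(H)|$ and, for $\alpha\in\mathbb{R}$, the $\alpha$-density is $g(H;\alpha)=|E(H)|-\alpha|V(H)|$. Problem LD: given $G$ and $f$, find a set of labels $L^*$ such that the density $d(H)$ of the label-induced subgraph $H=G(f,L^* )$ is maximized. Problem LD-$\alpha$: given $G$, $f$ and a constant $\alpha\in\mathbb{R}$, find a set of labels $L^*$ such that the $\alpha$-density $g(H;\alpha)$ of the label-induced subgraph $H=G(f,L^* )$ is maximized. A subgraph $H$ is said to solve one of these problems if it is the label-induced subgraph of an optimal label set.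
   Formalization: The "moreover" claim for α>τ is stated only if some label set induces the empty graph or some label-induced subgraph has density at least α; without this it is false (for large α a nonempty, non-densest subgraph with few vertices can be the only LD-α solution). *)

theory Defs
  imports Complex_Main
begin

record 'v graph =
  verts :: "'v set"
  edges :: "'v set set"

record ('v, 'l) labeled_graph = "'v graph" +
  lab :: "'v set \<Rightarrow> 'l set"

definition edge_labeled_graph :: "'l set \<Rightarrow> ('v, 'l) labeled_graph \<Rightarrow> bool" where
  "edge_labeled_graph L G \<longleftrightarrow>
     finite (verts G) \<and>
     (\<forall>e \<in> edges G. e \<subseteq> verts G \<and> card e = 2 \<and> lab G e \<subseteq> L)"

(* The first argument of an inducing function is the label set of an edge, the second one is
   the selected label set; the truth value plays the role of the binary number. *)
type_synonym 'l inducing_function = "'l set \<Rightarrow> 'l set \<Rightarrow> bool"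

definition induced_edges ::
    "('v, 'l) labeled_graph \<Rightarrow> 'l inducing_function \<Rightarrow> 'l set \<Rightarrow> 'v set set" where
  "induced_edges G f B = {e \<in> edges G. f (lab G e) B}"

(* Only the endpoints of selected edges are vertices: there are never isolated ones. *)
definition label_induced_subgraph ::
    "('v, 'l) labeled_graph \<Rightarrow> 'l inducing_function \<Rightarrow> 'l set \<Rightarrow> 'v graph" where
  "label_induced_subgraph G f B =
     \<lparr>verts = {v \<in> verts G. \<exists>e \<in> induced_edges G f B. v \<in> e},
      edges = induced_edges G f B\<rparr>"

definition empty_graph :: "'v graph" where
  "empty_graph = \<lparr>verts = {}, edges = {}\<rparr>"

(* The density of the empty graph is 0, because 0 / 0 = 0. *)
definition density :: "'v graph \<Rightarrow> real" where
  "density H = real (card (edges H)) / real (card (verts H))"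

definition alpha_density :: "'v graph \<Rightarrow> real \<Rightarrow> real" where
  "alpha_density H \<alpha> = real (card (edges H)) - \<alpha> * real (card (verts H))"

definition solves_LD ::
    "'l set \<Rightarrow> ('v, 'l) labeled_graph \<Rightarrow> 'l inducing_function \<Rightarrow> 'v graph \<Rightarrow> bool" where
  "solves_LD L G f H \<longleftrightarrow>
     (\<exists>B. is_arg_max (\<lambda>B. density (label_induced_subgraph G f B)) (\<lambda>B. B \<subseteq> L) B \<and>
          H = label_induced_subgraph G f B)"

definition solves_LD_alpha ::
    "'l set \<Rightarrow> ('v, 'l) labeled_graph \<Rightarrow> 'l inducing_function \<Rightarrow> real \<Rightarrow> 'v graph \<Rightarrow> bool" where
  "solves_LD_alpha L G f \<alpha> H \<longleftrightarrow>
     (\<exists>B. is_arg_max (\<lambda>B. alpha_density (label_induced_subgraph G f B) \<alpha>) (\<lambda>B. B \<subseteq> L) B \<and>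
          H = label_induced_subgraph G f B)"

end

theory Submission
  imports Defs
begin

text \<open>
  Only finitely many densities occur. Let \<open>\<tau>\<close> be the largest one below the maximum (or \<open>0\<close>), so
  that a density exceeding \<open>\<tau>\<close> is maximal. For nonempty \<open>H\<close> the sign of \<open>g(H; \<alpha>)\<close> is that of
  \<open>d(H) - \<alpha>\<close>. At \<open>\<tau>\<close> a densest subgraph has positive \<open>\<tau>\<close>-density, hence so has every solution of
  LD-\<open>\<tau>\<close>; for \<open>\<alpha> > \<tau>\<close> a nonempty solution has nonnegative \<open>\<alpha>\<close>-density, hence density at least
  \<open>\<alpha> > \<tau>\<close>.
\<close>

text \<open>Finiteness is required of the values only: \<open>L\<close> may be infinite, and then
  infinitely many label sets compete.\<close>

lemma ex_is_arg_max_finite_image: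
  fixes h :: "'a \<Rightarrow> 'b::linorder"
  assumes "finite (h ` {x. P x})" and "P x"
  shows "\<exists>y. is_arg_max h P y"
proof -
  have "Max (h ` {x. P x}) \<in> h ` {x. P x}"
    using assms by (intro Max_in) auto
  then obtain y where "P y" "h y = Max (h ` {x. P x})" by auto
  then show ?thesis
    using assms(1) by (intro exI[of _ y]) (auto simp: is_arg_max_linorder)
qed

lemma density_nonneg: "0 \<le> density H"
  by (simp add: density_def)

text \<open>Multiply by the vertex count. The empty graph must be excluded: its density and all its
  \<alpha>-densities are 0, so the first equivalence fails for negative \<alpha> and the second for
  positive \<alpha>.\<close>

lemma density_greater_iff:
  assumes "card (verts H) \<noteq> 0"
  shows "density H > \<alpha> \<longleftrightarrow> alpha_density H \<alpha> > 0"
    and "density H \<ge> \<alpha> \<longleftrightarrow> alpha_density H \<alpha> \<ge> 0"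
  using assms by (simp_all add: density_def alpha_density_def field_simps)

text \<open>An induced subgraph is determined by its edge set, which is one of the finitely many
  subsets of \<open>edges G\<close>.\<close>

lemma finite_label_induced_subgraphs:
  assumes "edge_labeled_graph L G"
  shows "finite (label_induced_subgraph G f ` S)"
proof -
  let ?H = "\<lambda>E. \<lparr>verts = {v \<in> verts G. \<exists>e \<in> E. v \<in> e}, edges = E\<rparr>"
  have "edges G \<subseteq> Pow (verts G)" and "finite (verts G)"
    using assms by (auto simp: edge_labeled_graph_def)
  then have "finite (edges G)"
    by (meson finite_Pow_iff finite_subset)
  then have "finite (?H ` Pow (edges G))" by simp
  moreover have "label_induced_subgraph G f ` S \<subseteq> ?H ` Pow (edges G)"
  proof
    fix K assume "K \<in> label_induced_subgraph G f ` S"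
    then obtain B where "K = ?H (induced_edges G f B)"
      by (auto simp: label_induced_subgraph_def)
    moreover have "induced_edges G f B \<in> Pow (edges G)"
      by (auto simp: induced_edges_def)
    ultimately show "K \<in> ?H ` Pow (edges G)" by (rule image_eqI)
  qed
  ultimately show ?thesis by (rule finite_subset[rotated])
qed

text \<open>Each selected edge brings its two endpoints along. Finiteness of \<open>verts G\<close>
  ensures that cardinality 0 means no vertices rather than infinitely many.\<close>

lemma label_induced_subgraph_eq_empty:
  assumes "edge_labeled_graph L G"
    and "card (verts (label_induced_subgraph G f B)) = 0"
  shows "label_induced_subgraph G f B = empty_graph"
proof -
  have "finite (verts G)" using assms(1) by (simp add: edge_labeled_graph_def)
  then have no_verts: "{v \<in> verts G. \<exists>e \<in> induced_edges G f B. v \<in> e} = {}"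
    using assms(2) by (simp add: label_induced_subgraph_def)
  have "induced_edges G f B = {}"
  proof (rule equals0I)
    fix e assume e: "e \<in> induced_edges G f B"
    then have "e \<subseteq> verts G" "card e = 2"
      using assms(1) by (auto simp: edge_labeled_graph_def induced_edges_def)
    moreover from \<open>card e = 2\<close> obtain v where "v \<in> e"
      by (metis card.empty equals0I zero_neq_numeral)
    ultimately show False using e no_verts by blast
  qed
  then show ?thesis
    by (simp add: label_induced_subgraph_def empty_graph_def)
qed

lemma alpha_density_empty_graph [simp]: "alpha_density empty_graph \<alpha> = 0"
  by (simp add: alpha_density_def empty_graph_def)

text \<open>The condition on \<open>B\<close> in the last clause provides a competitor of
  nonnegative \<alpha>-density. If all induced subgraphs are nonempty and \<alpha> is large, a
  sparser one with fewer vertices can win.\<close>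

theorem theorem6:
  fixes L :: "'l set"
    and G :: "('v, 'l) labeled_graph"
    and f :: "'l inducing_function"
  assumes "edge_labeled_graph L G"
  shows "\<exists>\<tau>::real.
    (\<exists>H. solves_LD_alpha L G f \<tau> H) \<and>
    (\<forall>H. solves_LD_alpha L G f \<tau> H \<longrightarrow> solves_LD L G f H) \<and>
    (\<forall>\<alpha>>\<tau>.
       (\<exists>B\<subseteq>L. label_induced_subgraph G f B = empty_graph \<or>
               \<alpha> \<le> density (label_induced_subgraph G f B)) \<longrightarrow>
       (\<forall>H. solves_LD_alpha L G f \<alpha> H \<longrightarrow> solves_LD L G f H \<or> H = empty_graph))"
proof -
  define H where "H = label_induced_subgraph G f"
  define D where "D = density ` H ` Pow L"
  have fin_H: "finite (H ` S)" for S
    unfolding H_def by (rule finite_label_induced_subgraphs[OF assms])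
  have fin_D: "finite D"
    unfolding D_def by (intro finite_imageI fin_H)
  have "\<exists>B. is_arg_max (\<lambda>B. density (H B)) (\<lambda>B. B \<subseteq> L) B"
    using finite_imageI[OF fin_H, of density "{B. B \<subseteq> L}"]
    by (intro ex_is_arg_max_finite_image[of _ _ "{}"]) (simp_all add: image_image)
  then obtain B0 where B0: "B0 \<subseteq> L" and B0_max: "\<And>B. B \<subseteq> L \<Longrightarrow> density (H B) \<le> density (H B0)"
    unfolding is_arg_max_linorder by blast
  \<comment> \<open>Inserting 0 keeps the set nonempty when every label set attains the maximal
    density.\<close>
  define \<tau> where "\<tau> = Max (insert 0 {d \<in> D. d < density (H B0)})"
  have LD_I: "solves_LD L G f (H B)" if "B \<subseteq> L" "density (H B) \<ge> density (H B0)" for B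
  proof -
    have "\<forall>C\<subseteq>L. density (H C) \<le> density (H B)"
      using order_trans[OF B0_max that(2)] by simp
    with that(1) have "is_arg_max (\<lambda>B. density (H B)) (\<lambda>B. B \<subseteq> L) B"
      by (simp only: is_arg_max_linorder simp_thms)
    then show ?thesis
      unfolding solves_LD_def H_def by (intro exI[of _ B]) simp
  qed
  have above: "solves_LD L G f (H B)" if "B \<subseteq> L" "density (H B) > \<tau>" for B
  proof (rule LD_I[OF that(1)], rule ccontr)
    assume "\<not> density (H B) \<ge> density (H B0)"
    then have "density (H B) \<le> \<tau>"
      unfolding \<tau>_def using fin_D that(1) by (intro Max_ge) (auto simp: D_def)
    with that(2) show False by simp
  qed
  have empty: "H B = empty_graph" if "card (verts (H B)) = 0" for B
    using label_induced_subgraph_eq_empty[OF assms] that unfolding H_def .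
  have alpha_D: "\<exists>B\<subseteq>L. K = H B \<and> (\<forall>C\<subseteq>L. alpha_density (H C) \<alpha> \<le> alpha_density (H B) \<alpha>)"
    if "solves_LD_alpha L G f \<alpha> K" for \<alpha> K
    using that unfolding solves_LD_alpha_def is_arg_max_linorder H_def by metis

  have solvable: "\<exists>K. solves_LD_alpha L G f \<tau> K"
  proof -
    have "\<exists>B. is_arg_max (\<lambda>B. alpha_density (H B) \<tau>) (\<lambda>B. B \<subseteq> L) B"
      using finite_imageI[OF fin_H, of "\<lambda>K. alpha_density K \<tau>" "{B. B \<subseteq> L}"]
      by (intro ex_is_arg_max_finite_image[of _ _ "{}"]) (simp_all add: image_image)
    then show ?thesis
      unfolding solves_LD_alpha_def H_def by metis
  qed
  have at_\<tau>: "solves_LD L G f K" if K: "solves_LD_alpha L G f \<tau> K" for K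
  proof -
    obtain B where B: "B \<subseteq> L" "K = H B"
      and max: "\<And>C. C \<subseteq> L \<Longrightarrow> alpha_density (H C) \<tau> \<le> alpha_density (H B) \<tau>"
      using alpha_D[OF K] by blast
    show ?thesis
    \<comment> \<open>If the maximal density is 0, then \<tau> is 0 too and not below it, but every
      label set is optimal.\<close>
    proof (cases "density (H B0) = 0")
      case True
      then show ?thesis using LD_I[OF B(1)] B(2) by (simp add: density_nonneg)
    next
      case False
      then have "card (verts (H B0)) \<noteq> 0" by (auto simp: density_def)
      moreover have "density (H B0) > \<tau>"
        using False fin_D density_nonneg[of "H B0"] by (auto simp: \<tau>_def)
      ultimately have "alpha_density (H B0) \<tau> > 0"
        using density_greater_iff(1) by blast
      then have pos: "alpha_density (H B) \<tau> > 0" using max[OF B0] by simp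
      then have "card (verts (H B)) \<noteq> 0"
        by (metis alpha_density_empty_graph empty less_irrefl)
      then show ?thesis using pos above B density_greater_iff(1) by blast
    qed
  qed
  have above_\<tau>: "solves_LD L G f K \<or> K = empty_graph"
    if \<alpha>: "\<alpha> > \<tau>" and C: "C \<subseteq> L" "H C = empty_graph \<or> \<alpha> \<le> density (H C)"
      and K: "solves_LD_alpha L G f \<alpha> K" for \<alpha> C K
  proof -
    obtain B where B: "B \<subseteq> L" "K = H B"
      and max: "\<And>C. C \<subseteq> L \<Longrightarrow> alpha_density (H C) \<alpha> \<le> alpha_density (H B) \<alpha>"
      using alpha_D[OF K] by blast
    \<comment> \<open>An empty \<open>H C\<close> has \<alpha>-density exactly 0; otherwise the sign
      equivalence applies.\<close>
    have "alpha_density (H C) \<alpha> \<ge> 0"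
      by (metis C(2) empty density_greater_iff(2) alpha_density_empty_graph order_refl)
    then have "alpha_density (H B) \<alpha> \<ge> 0" using max[OF C(1)] by simp
    then have "card (verts (H B)) \<noteq> 0 \<Longrightarrow> density (H B) > \<tau>"
      using \<alpha> density_greater_iff(2)[of "H B" \<alpha>] by simp
    then show ?thesis using above B empty by blast
  qed
  show ?thesis
  proof (intro exI[of _ \<tau>] conjI allI impI)
    fix \<alpha> K
    assume "\<alpha> > \<tau>" and "solves_LD_alpha L G f \<alpha> K"
      and "\<exists>B\<subseteq>L. label_induced_subgraph G f B = empty_graph \<or>
              \<alpha> \<le> density (label_induced_subgraph G f B)"
    then show "solves_LD L G f K \<or> K = empty_graph"
      using above_\<tau> unfolding H_def by metis
  qed (fact solvable, erule at_\<tau>)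
qed

end
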